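(* Let $k$ be a fixed positive integer. Given a graph $G$ with $n$ vertices and $m$ edges, it can be decided in time $O(m^{k-1}n^4)$ whether $G$ is $k$-well-indumatched.
   Context: All graphs are finite, simple and undirected. An induced matching of a graph $G$ is a set $M$ of edges, no two sharing an endpoint, such that no edge of $G$ joins an endpoint of one edge of $M$ to an endpoint of another edge of $M$. A graph is $k$-well-indumatched if all of its inclusion-wise maximal induced matchings have size exactly $k$. *)

theory Defs
  imports Main
begin

section \<open>Graphs and induced matchings\<close>

definition simple_graph :: "'a set \<Rightarrow> 'a set set \<Rightarrow> bool" where
  "simple_graph V E \<longleftrightarrow> finite V \<and> (\<forall>e\<in>E. e \<subseteq> V \<and> card e = 2)"

definition induced_matching :: "'a set set \<Rightarrow> 'a set set \<Rightarrow> bool" where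
  "induced_matching E M \<longleftrightarrow> M \<subseteq> E \<and>
     (\<forall>e\<in>M. \<forall>f\<in>M. e \<noteq> f \<longrightarrow> e \<inter> f = {} \<and> (\<forall>x\<in>e. \<forall>y\<in>f. {x, y} \<notin> E))"

definition maximal_induced_matching :: "'a set set \<Rightarrow> 'a set set \<Rightarrow> bool" where
  "maximal_induced_matching E M \<longleftrightarrow> induced_matching E M \<and>
     (\<forall>M'. induced_matching E M' \<and> M \<subseteq> M' \<longrightarrow> M' = M)"

definition well_indumatched :: "nat \<Rightarrow> 'a set set \<Rightarrow> bool" where
  "well_indumatched k E \<longleftrightarrow> (\<forall>M. maximal_induced_matching E M \<longrightarrow> card M = k)"


section \<open>Random access machines\<close>

text \<open>
  A machine has registers, addressed only by constants in the program text, and a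
  separate random access memory, reached only through \<open>Load\<close> and \<open>Store\<close>.
  Every instruction has unit cost.  Cells hold natural numbers; so that unit cost is
  legitimate, \<open>decides_within\<close> below also bounds all cell contents during the
  computation.  \<open>Sub\<close> is truncated subtraction.
\<close>

datatype instr =
    Const nat nat
  | Add nat nat nat
  | Sub nat nat nat
  | Mul nat nat nat
  | Load nat nat
  | Store nat nat
  | Jump nat
  | Jump_less nat nat nat
  | Halt bool

type_synonym program = "instr list"

record state =
  pc :: nat
  reg :: "nat \<Rightarrow> nat"
  mem :: "nat \<Rightarrow> nat"

fun exec_instr :: "instr \<Rightarrow> state \<Rightarrow> state" where
  "exec_instr (Const r c) s = s\<lparr>pc := pc s + 1, reg := (reg s)(r := c)\<rparr>"
| "exec_instr (Add r a b) s = s\<lparr>pc := pc s + 1, reg := (reg s)(r := reg s a + reg s b)\<rparr>"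
| "exec_instr (Sub r a b) s = s\<lparr>pc := pc s + 1, reg := (reg s)(r := reg s a - reg s b)\<rparr>"
| "exec_instr (Mul r a b) s = s\<lparr>pc := pc s + 1, reg := (reg s)(r := reg s a * reg s b)\<rparr>"
| "exec_instr (Load r a) s = s\<lparr>pc := pc s + 1, reg := (reg s)(r := mem s (reg s a))\<rparr>"
| "exec_instr (Store a r) s = s\<lparr>pc := pc s + 1, mem := (mem s)(reg s a := reg s r)\<rparr>"
| "exec_instr (Jump l) s = s\<lparr>pc := l\<rparr>"
| "exec_instr (Jump_less a b l) s = s\<lparr>pc := (if reg s a < reg s b then l else pc s + 1)\<rparr>"
| "exec_instr (Halt v) s = s"

text \<open>A machine whose program counter has left the program is stuck; this does not count as halting.\<close>

definition step :: "program \<Rightarrow> state \<Rightarrow> state" where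
  "step P s = (if pc s < length P then exec_instr (P ! pc s) s else s)"

definition halted_with :: "program \<Rightarrow> state \<Rightarrow> bool \<Rightarrow> bool" where
  "halted_with P s v \<longleftrightarrow> pc s < length P \<and> P ! pc s = Halt v"

definition words_bounded :: "nat \<Rightarrow> state \<Rightarrow> bool" where
  "words_bounded W s \<longleftrightarrow> (\<forall>r. reg s r \<le> W) \<and> (\<forall>a. mem s a \<le> W)"

text \<open>
  \<open>decides_within P s v T W\<close>: started in \<open>s\<close>, the program \<open>P\<close> halts with verdict \<open>v\<close>
  after at most \<open>T\<close> steps, and no cell ever contains a number larger than \<open>W\<close>.
\<close>

definition decides_within :: "program \<Rightarrow> state \<Rightarrow> bool \<Rightarrow> nat \<Rightarrow> nat \<Rightarrow> bool" where
  "decides_within P s v T W \<longleftrightarrow>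
     (\<exists>t\<le>T. halted_with P ((step P ^^ t) s) v \<and> (\<forall>i\<le>t. words_bounded W ((step P ^^ i) s)))"

text \<open>
  Input format for a graph with vertex set \<open>{..<n}\<close>: cell \<open>0\<close> of the memory holds \<open>n\<close>,
  followed by the adjacency matrix in row-major order; everything else is \<open>0\<close>.
\<close>

definition adjacency_input :: "nat \<Rightarrow> nat set set \<Rightarrow> state" where
  "adjacency_input n E =
     \<lparr>pc = 0, reg = (\<lambda>_. 0),
      mem = (\<lambda>a. if a = 0 then n
                  else if a \<le> n * n \<and> {(a - 1) div n, (a - 1) mod n} \<in> E then 1
                  else 0)\<rparr>"

end

theory Submission
  imports Defs
begin

text \<open>
  A brute-force search suffices: there are at most \<open>m ^ (k + 1)\<close> sequences of \<open>k + 1\<close> edges, and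
  \<open>m\<^sup>2 \<le> n ^ 4\<close>.  A graph is \<open>k\<close>-well-indumatched iff every induced matching with fewer than \<open>k\<close>
  edges can be extended and none has \<open>k + 1\<close> edges.  Since edges that coincide or
  meet always have adjacent endpoints, an edge extends an induced matching iff the adjacency
  matrix vanishes between its endpoints and those of the chosen edges, so one extension is tested
  in constant time.  The machine program is \<open>k + 1\<close> nested loops over an edge list that is
  extracted in time \<open>O(n\<^sup>2)\<close>; it is written in a small language of bounded loops, for which
  running time and word sizes can be read off the syntax.
\<close>


section \<open>A language of bounded loops\<close>

datatype com =
    Basic instr
  | Seq com com (infixr \<open>;;\<close> 60)
  | When nat nat com
  | Incr nat nat
  | Loop nat nat com

type_synonym store = "(nat \<Rightarrow> nat) \<times> (nat \<Rightarrow> nat)"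

definition at :: "nat \<Rightarrow> store \<Rightarrow> state" where
  "at l \<sigma> = \<lparr>pc = l, reg = fst \<sigma>, mem = snd \<sigma>\<rparr>"

lemma at_simps [simp]:
  "pc (at l \<sigma>) = l" "reg (at l \<sigma>) = fst \<sigma>" "mem (at l \<sigma>) = snd \<sigma>"
  by (simp_all add: at_def)

lemma at_update [simp]:
  "(at l \<sigma>)\<lparr>pc := l'\<rparr> = at l' \<sigma>"
  "(at l \<sigma>)\<lparr>pc := l', reg := f\<rparr> = at l' (f, snd \<sigma>)"
  "(at l \<sigma>)\<lparr>pc := l', mem := g\<rparr> = at l' (fst \<sigma>, g)"
  by (simp_all add: at_def)

definition bump :: "nat \<Rightarrow> store \<Rightarrow> store" where
  "bump r \<sigma> = ((fst \<sigma>)(r := fst \<sigma> r + 1), snd \<sigma>)"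

lemma bump_simps [simp]:
  "fst (bump r \<sigma>) = (fst \<sigma>)(r := fst \<sigma> r + 1)" "snd (bump r \<sigma>) = snd \<sigma>"
  by (simp_all add: bump_def)

text \<open>The number of rounds of a \<open>Loop\<close> is read once, on entry. Compiled code
  rereads \<open>b\<close> before every round; the two agree once \<open>typed\<close> forbids the
  body to write \<open>b\<close>.\<close>

fun sem :: "com \<Rightarrow> store \<Rightarrow> store" where
  "sem (Basic ins) \<sigma> = (reg (exec_instr ins (at 0 \<sigma>)), mem (exec_instr ins (at 0 \<sigma>)))"
| "sem (c ;; d) \<sigma> = sem d (sem c \<sigma>)"
| "sem (When a b c) \<sigma> = (if fst \<sigma> a < fst \<sigma> b then sem c \<sigma> else \<sigma>)"
| "sem (Incr r b) \<sigma> = (if fst \<sigma> r < fst \<sigma> b then bump r \<sigma> else \<sigma>)"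
| "sem (Loop i b c) \<sigma> = ((\<lambda>\<tau>. bump i (sem c \<tau>)) ^^ fst \<sigma> b) ((fst \<sigma>)(i := 0), snd \<sigma>)"

text \<open>Compiled code assumes that register \<open>1\<close> constantly holds \<open>1\<close>.\<close>

fun compile :: "nat \<Rightarrow> com \<Rightarrow> program" where
  "compile l (Basic ins) = [ins]"
| "compile l (c ;; d) = compile l c @ compile (l + length (compile l c)) d"
| "compile l (When a b c) =
     [Jump_less a b (l + 2), Jump (l + 2 + length (compile (l + 2) c))] @ compile (l + 2) c"
| "compile l (Incr r b) = [Jump_less r b (l + 2), Jump (l + 3), Add r r 1]"
| "compile l (Loop i b c) =
     [Const i 0, Jump (l + 3 + length (compile (l + 2) c))] @ compile (l + 2) c @
     [Add i i 1, Jump_less i b (l + 2)]"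

section \<open>Frame conditions read off the syntax\<close>

fun instr_writes :: "instr \<Rightarrow> nat set" where
  "instr_writes (Const r c) = {r}"
| "instr_writes (Add r a b) = {r}"
| "instr_writes (Sub r a b) = {r}"
| "instr_writes (Mul r a b) = {r}"
| "instr_writes (Load r a) = {r}"
| "instr_writes _ = {}"

fun writes :: "com \<Rightarrow> nat set" where
  "writes (Basic ins) = instr_writes ins"
| "writes (c ;; d) = writes c \<union> writes d"
| "writes (When a b c) = writes c"
| "writes (Incr r b) = {r}"
| "writes (Loop i b c) = insert i (writes c)"

fun instr_stores :: "instr \<Rightarrow> bool" where
  "instr_stores (Store a r) = True"
| "instr_stores _ = False"

fun stores :: "com \<Rightarrow> bool" where
  "stores (Basic ins) = instr_stores ins"
| "stores (c ;; d) = (stores c \<or> stores d)"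
| "stores (When a b c) = stores c"
| "stores (Incr r b) = False"
| "stores (Loop i b c) = stores c"

lemma sem_unwritten: "r \<notin> writes c \<Longrightarrow> fst (sem c \<sigma>) r = fst \<sigma> r"
proof (induction c arbitrary: \<sigma>)
  case (Basic ins)
  then show ?case by (cases ins) auto
next
  case (Loop i b c)
  have "fst (((\<lambda>\<tau>. bump i (sem c \<tau>)) ^^ q) ((fst \<sigma>)(i := 0), snd \<sigma>)) r = fst \<sigma> r" for q
    using Loop by (induction q) (auto simp: bump_def)
  then show ?case by simp
qed (auto simp: bump_def)

lemma sem_no_stores: "\<not> stores c \<Longrightarrow> snd (sem c \<sigma>) = snd \<sigma>"
proof (induction c arbitrary: \<sigma>)
  case (Basic ins)
  then show ?case by (cases ins) auto
next
  case (Loop i b c)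
  have "snd (((\<lambda>\<tau>. bump i (sem c \<tau>)) ^^ q) ((fst \<sigma>)(i := 0), snd \<sigma>)) = snd \<sigma>" for q
    using Loop by (induction q) (auto simp: bump_def)
  then show ?case by simp
qed (auto simp: bump_def)

text \<open>Since the body never writes \<open>i\<close>, the counter equals the number of completed
  rounds; this is why the step premise may assume \<open>fst \<tau> i = q\<close>.\<close>

lemma sem_Loop_invariant:
  assumes "i \<notin> writes c" "fst \<sigma> b = n"
    and "I 0 ((fst \<sigma>)(i := 0), snd \<sigma>)"
    and "\<And>q \<tau>. \<lbrakk>I q \<tau>; q < n; fst \<tau> i = q\<rbrakk> \<Longrightarrow> I (Suc q) (bump i (sem c \<tau>))"
  shows "I n (sem (Loop i b c) \<sigma>)"
proof -
  define st where "st q = ((\<lambda>\<tau>. bump i (sem c \<tau>)) ^^ q) ((fst \<sigma>)(i := 0), snd \<sigma>)" for q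
  have st_Suc: "st (Suc q) = bump i (sem c (st q))" for q by (simp add: st_def)
  have "q \<le> n \<longrightarrow> I q (st q) \<and> fst (st q) i = q" for q
  proof (induction q)
    case 0
    then show ?case using assms(3) by (simp add: st_def)
  next
    case (Suc q)
    then show ?case
      using assms(4)[of q "st q"] sem_unwritten[OF assms(1), of "st q"] st_Suc by auto
  qed
  then show ?thesis using assms(2) by (simp add: st_def)
qed


section \<open>Word sizes and running times\<close>

text \<open>
  \<open>B r\<close> bounds register \<open>r\<close> and \<open>D\<close> bounds every memory cell.  Arithmetic must respect the
  bounds of its operands, so a register can only be increased repeatedly by \<open>Incr\<close> or as a
  loop counter, where the guard provides the bound.
\<close>

fun instr_typed :: "(nat \<Rightarrow> nat) \<Rightarrow> nat \<Rightarrow> instr \<Rightarrow> bool" where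
  "instr_typed B D (Const r c) = (r \<noteq> 1 \<and> c \<le> B r)"
| "instr_typed B D (Add r a b) = (r \<noteq> 1 \<and> B a + B b \<le> B r)"
| "instr_typed B D (Sub r a b) = (r \<noteq> 1 \<and> B a \<le> B r)"
| "instr_typed B D (Mul r a b) = (r \<noteq> 1 \<and> B a * B b \<le> B r)"
| "instr_typed B D (Load r a) = (r \<noteq> 1 \<and> D \<le> B r)"
| "instr_typed B D (Store a r) = (B r \<le> D)"
| "instr_typed B D _ = False"

fun typed :: "(nat \<Rightarrow> nat) \<Rightarrow> nat \<Rightarrow> com \<Rightarrow> bool" where
  "typed B D (Basic ins) = instr_typed B D ins"
| "typed B D (c ;; d) = (typed B D c \<and> typed B D d)"
| "typed B D (When a b c) = typed B D c"
| "typed B D (Incr r b) = (r \<noteq> 1 \<and> B b \<le> B r)"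
| "typed B D (Loop i b c) =
     (i \<noteq> 1 \<and> i \<noteq> b \<and> i \<notin> writes c \<and> b \<notin> writes c \<and> B b \<le> B i \<and> typed B D c)"

text \<open>Worst-case instruction counts of the compiled code. For a loop, \<open>3\<close> is the
  initialisation, the jump to the test and the last, failing test; each round adds one test and one
  increment.\<close>

fun cost :: "(nat \<Rightarrow> nat) \<Rightarrow> com \<Rightarrow> nat" where
  "cost B (Basic ins) = 1"
| "cost B (c ;; d) = cost B c + cost B d"
| "cost B (When a b c) = 2 + cost B c"
| "cost B (Incr r b) = 2"
| "cost B (Loop i b c) = 3 + B b * (2 + cost B c)"

text \<open>The last conjunct makes the compiled \<open>Add r r 1\<close> an increment; typed
  commands preserve it by never writing register \<open>1\<close>.\<close>

definition within :: "(nat \<Rightarrow> nat) \<Rightarrow> nat \<Rightarrow> store \<Rightarrow> bool" where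
  "within B D \<sigma> \<longleftrightarrow> (\<forall>r. fst \<sigma> r \<le> B r) \<and> (\<forall>a. snd \<sigma> a \<le> D) \<and> fst \<sigma> 1 = 1"

section \<open>Placement of code and bounded machine runs\<close>

definition code_at :: "program \<Rightarrow> nat \<Rightarrow> program \<Rightarrow> bool" where
  "code_at P l Q \<longleftrightarrow> (\<exists>X Y. P = X @ Q @ Y \<and> length X = l)"

lemma code_at_append:
  "code_at P l (Q @ R) \<longleftrightarrow> code_at P l Q \<and> code_at P (l + length Q) R"
proof
  assume "code_at P l (Q @ R)"
  then obtain X Y where "P = X @ (Q @ R) @ Y" "length X = l"
    unfolding code_at_def by blast
  then have "P = X @ Q @ (R @ Y)" "P = (X @ Q) @ R @ Y" "length (X @ Q) = l + length Q" by auto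
  then show "code_at P l Q \<and> code_at P (l + length Q) R"
    unfolding code_at_def using \<open>length X = l\<close> by blast
next
  assume "code_at P l Q \<and> code_at P (l + length Q) R"
  then obtain X Y X' Y' where *: "P = X @ Q @ Y" "length X = l"
    "P = X' @ R @ Y'" "length X' = l + length Q"
    unfolding code_at_def by blast
  then have "X' = X @ Q" by (metis append.assoc append_eq_append_conv length_append)
  then show "code_at P l (Q @ R)"
    unfolding code_at_def using * by (metis append.assoc)
qed

lemma code_at_Cons:
  "code_at P l (ins # Q) \<longleftrightarrow> l < length P \<and> P ! l = ins \<and> code_at P (Suc l) Q"
proof -
  have "code_at P l [ins] \<longleftrightarrow> l < length P \<and> P ! l = ins"
    unfolding code_at_def
    by (auto simp: nth_append) (metis id_take_nth_drop length_take min.absorb4)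
  then show ?thesis using code_at_append[of P l "[ins]" Q] by simp
qed

text \<open>\<open>Q\<close> is demanded of every state passed, both ends included, because word
  sizes have to be bounded throughout a computation.\<close>

definition runs :: "program \<Rightarrow> (state \<Rightarrow> bool) \<Rightarrow> nat \<Rightarrow> state \<Rightarrow> state \<Rightarrow> bool" where
  "runs P Q T s s' \<longleftrightarrow> (\<exists>t\<le>T. (step P ^^ t) s = s' \<and> (\<forall>i\<le>t. Q ((step P ^^ i) s)))"

lemma runs_trans:
  assumes "runs P Q T s s'" "runs P Q T' s' s''"
  shows "runs P Q (T + T') s s''"
proof -
  obtain t t' where t: "t \<le> T" "(step P ^^ t) s = s'" "\<forall>i\<le>t. Q ((step P ^^ i) s)"
    and t': "t' \<le> T'" "(step P ^^ t') s' = s''" "\<forall>i\<le>t'. Q ((step P ^^ i) s')"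
    using assms unfolding runs_def by blast
  have "Q ((step P ^^ i) s)" if "i \<le> t + t'" for i
  proof (cases "i \<le> t")
    case False
    then obtain j where "i = j + t" by (metis add.commute le_Suc_ex nat_le_linear)
    then show ?thesis using t t' that by (simp add: funpow_add)
  qed (use t in blast)
  moreover have "(step P ^^ (t' + t)) s = s''" using t t' by (simp add: funpow_add)
  ultimately show ?thesis
    unfolding runs_def using t t' by (intro exI[of _ "t' + t"]) (auto simp: add.commute)
qed

lemma runs_mono: "runs P Q T s s' \<Longrightarrow> T \<le> T' \<Longrightarrow> runs P Q T' s s'"
  unfolding runs_def using le_trans by blast

lemma runs_step: "Q s \<Longrightarrow> Q s' \<Longrightarrow> step P s = s' \<Longrightarrow> runs P Q 1 s s'"
  unfolding runs_def by (rule exI[of _ 1]) (auto simp: le_Suc_eq)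

lemma exec_instr_typed:
  "instr_typed B D ins \<Longrightarrow> exec_instr ins (at l \<sigma>) = at (Suc l) (sem (Basic ins) \<sigma>)"
  by (cases ins) auto

lemma within_Basic:
  assumes "instr_typed B D ins" "within B D \<sigma>"
  shows "within B D (sem (Basic ins) \<sigma>)"
proof -
  have *: "fst \<sigma> r \<le> B r" "snd \<sigma> a \<le> D" "fst \<sigma> 1 = 1" for r a
    using assms(2) by (auto simp: within_def)
  have "fst \<sigma> a + fst \<sigma> b \<le> B a + B b" "fst \<sigma> a * fst \<sigma> b \<le> B a * B b"
    "fst \<sigma> a - fst \<sigma> b \<le> B a" for a b
    using * by (auto intro: add_mono mult_mono le_trans[OF diff_le_self])
  note ** = this[THEN le_trans] *(1,2)[THEN le_trans]
  show ?thesis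
    using assms(1) * by (cases ins) (auto simp: within_def intro: **)
qed

lemma within_bump:
  "within B D \<sigma> \<Longrightarrow> fst \<sigma> r < B r \<Longrightarrow> r \<noteq> 1 \<Longrightarrow> within B D (bump r \<sigma>)"
  by (auto simp: within_def bump_def Suc_le_eq)

lemma runs_instr:
  assumes "within B D \<sigma>" "within B D \<tau>" "l < length P" "exec_instr (P ! l) (at l \<sigma>) = at l' \<tau>"
  shows "runs P (\<lambda>s. within B D (reg s, mem s)) 1 (at l \<sigma>) (at l' \<tau>)"
  using assms by (intro runs_step) (auto simp: step_def)

text \<open>Induction on the command for arbitrary start addresses, since subcommands sit at shifted
  positions. Word and time bounds are proved together: a loop makes at most \<open>B b\<close>
  rounds because its store is \<open>within\<close> the bounds.\<close>

theorem compile_correct: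
  assumes "typed B D c" "within B D \<sigma>" "code_at P l (compile l c)"
  shows "within B D (sem c \<sigma>) \<and>
    runs P (\<lambda>s. within B D (reg s, mem s)) (cost B c)
      (at l \<sigma>) (at (l + length (compile l c)) (sem c \<sigma>))"
  using assms
proof (induction c arbitrary: \<sigma> l)
  case (Basic ins)
  then show ?case
    using within_Basic[of B D ins \<sigma>] exec_instr_typed[of B D ins l \<sigma>]
    by (auto simp: code_at_Cons intro!: runs_instr[simplified] simp del: sem.simps(1))
next
  case (Seq c d)
  let ?l = "l + length (compile l c)"
  have code: "code_at P l (compile l c)" "code_at P ?l (compile ?l d)"
    using Seq.prems(3) by (simp_all add: code_at_append)
  have wt: "typed B D c" "typed B D d" using Seq.prems(1) by auto
  note c = Seq.IH(1)[OF wt(1) Seq.prems(2) code(1)]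
  note d = Seq.IH(2)[OF wt(2) conjunct1[OF c] code(2)]
  show ?case using d runs_trans[OF conjunct2[OF c] conjunct2[OF d]] by (simp add: add.assoc)
next
  case (When a b c)
  let ?Q = "\<lambda>s. within B D (reg s, mem s)" and ?n = "length (compile (l + 2) c)"
  have code: "l < length P" "P ! l = Jump_less a b (l + 2)"
    "Suc l < length P" "P ! Suc l = Jump (l + 2 + ?n)" "code_at P (l + 2) (compile (l + 2) c)"
    using When.prems(3) by (auto simp: code_at_Cons)
  show ?case
  proof (cases "fst \<sigma> a < fst \<sigma> b")
    case True
    have "runs P ?Q 1 (at l \<sigma>) (at (l + 2) \<sigma>)"
      using When.prems code True by (intro runs_instr) auto
    moreover have "typed B D c" using When.prems(1) by simp
    note c = When.IH[OF this When.prems(2) code(5)]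
    note runs_mono[OF runs_trans[OF calculation conjunct2[OF c]], of "cost B (When a b c)"]
    then show ?thesis using c True by (simp add: add.assoc)
  next
    case False
    have "runs P ?Q 1 (at l \<sigma>) (at (Suc l) \<sigma>)" "runs P ?Q 1 (at (Suc l) \<sigma>) (at (l + 2 + ?n) \<sigma>)"
      using When.prems code False by (auto intro!: runs_instr[simplified])
    from runs_mono[OF runs_trans[OF this], of "cost B (When a b c)"] show ?thesis
      using When.prems False by (simp add: add.assoc)
  qed
next
  case (Incr r b)
  let ?Q = "\<lambda>s. within B D (reg s, mem s)"
  have code: "l < length P" "P ! l = Jump_less r b (l + 2)"
    "Suc l < length P" "P ! Suc l = Jump (l + 3)" "l + 2 < length P" "P ! (l + 2) = Add r r 1"
    using Incr.prems(3) by (auto simp: code_at_Cons)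
  have one: "fst \<sigma> 1 = 1" and le: "fst \<sigma> b \<le> B b"
    using Incr.prems(2) by (auto simp: within_def)
  show ?case
  proof (cases "fst \<sigma> r < fst \<sigma> b")
    case True
    have w: "within B D (bump r \<sigma>)"
      using Incr.prems True le by (intro within_bump) auto
    have "runs P ?Q 1 (at l \<sigma>) (at (l + 2) \<sigma>)" "runs P ?Q 1 (at (l + 2) \<sigma>) (at (l + 3) (bump r \<sigma>))"
      using Incr.prems code True w one by (auto intro!: runs_instr[simplified] simp: bump_def)
    from runs_trans[OF this] show ?thesis using w True by (simp add: numeral_eq_Suc)
  next
    case False
    have "runs P ?Q 1 (at l \<sigma>) (at (Suc l) \<sigma>)" "runs P ?Q 1 (at (Suc l) \<sigma>) (at (l + 3) \<sigma>)"
      using Incr.prems code False by (auto intro!: runs_instr[simplified])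
    from runs_trans[OF this] show ?thesis using Incr.prems False by (simp add: numeral_eq_Suc)
  qed
next
  case (Loop i b c)
  let ?Q = "\<lambda>s. within B D (reg s, mem s)" and ?n = "length (compile (l + 2) c)"
  define st where "st q = ((\<lambda>\<tau>. bump i (sem c \<tau>)) ^^ q) ((fst \<sigma>)(i := 0), snd \<sigma>)" for q
  have st: "st 0 = ((fst \<sigma>)(i := 0), snd \<sigma>)" "st (Suc q) = bump i (sem c (st q))"
    "sem (Loop i b c) \<sigma> = st (fst \<sigma> b)" for q
    by (simp_all add: st_def)
  have code: "l < length P" "P ! l = Const i 0" "Suc l < length P" "P ! Suc l = Jump (l + 3 + ?n)"
    "code_at P (l + 2) (compile (l + 2) c)" "l + 2 + ?n < length P" "P ! (l + 2 + ?n) = Add i i 1"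
    "l + 3 + ?n < length P" "P ! (l + 3 + ?n) = Jump_less i b (l + 2)"
    using Loop.prems(3) by (auto simp: code_at_Cons code_at_append numeral_eq_Suc)
  have wt: "i \<noteq> 1" "i \<noteq> b" "i \<notin> writes c" "b \<notin> writes c" "B b \<le> B i" "typed B D c"
    using Loop.prems(1) by auto
  have w0: "within B D (st 0)" using Loop.prems(2) wt(1) by (auto simp: within_def st)
  \<comment> \<open>Control first jumps to the test at the foot of the loop, so that zero rounds are
    possible.\<close>
  have "runs P ?Q 1 (at l \<sigma>) (at (Suc l) (st 0))"
    "runs P ?Q 1 (at (Suc l) (st 0)) (at (l + 3 + ?n) (st 0))"
    using Loop.prems(2) code w0 by (auto intro!: runs_instr[simplified] simp: st(1))
  note init = runs_trans[OF this]
  have lim: "fst \<sigma> b \<le> B b" using Loop.prems(2) by (auto simp: within_def)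
  \<comment> \<open>After \<open>q\<close> rounds the machine stands at the closing test with
    \<open>b\<close> unchanged. The summand \<open>2\<close> pays for the initialisation and the
    first jump.\<close>
  have "q \<le> fst \<sigma> b \<longrightarrow> within B D (st q) \<and> fst (st q) i = q \<and> fst (st q) b = fst \<sigma> b \<and>
      runs P ?Q (2 + q * (2 + cost B c)) (at l \<sigma>) (at (l + 3 + ?n) (st q))" for q
  proof (induction q)
    case 0
    then show ?case using init w0 wt(2) by (simp add: numeral_eq_Suc st(1))
  next
    case (Suc q)
    show ?case
    proof
      assume le: "Suc q \<le> fst \<sigma> b"
      let ?\<tau> = "st q"
      have w: "within B D ?\<tau>" and i: "fst ?\<tau> i = q" and b: "fst ?\<tau> b = fst \<sigma> b"
        and r0: "runs P ?Q (2 + q * (2 + cost B c)) (at l \<sigma>) (at (l + 3 + ?n) ?\<tau>)"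
        using Suc.IH le by auto
      have r1: "runs P ?Q 1 (at (l + 3 + ?n) ?\<tau>) (at (l + 2) ?\<tau>)"
        using w code i b le by (auto intro!: runs_instr[simplified])
      have w2: "within B D (sem c ?\<tau>)"
        and r2: "runs P ?Q (cost B c) (at (l + 2) ?\<tau>) (at (l + 2 + ?n) (sem c ?\<tau>))"
        using Loop.IH[OF wt(6) w code(5)] by auto
      have i2: "fst (sem c ?\<tau>) i = q" and b2: "fst (sem c ?\<tau>) b = fst \<sigma> b"
        using i b wt by (auto simp: sem_unwritten)
      \<comment> \<open>The counter may grow because \<open>q < fst \<sigma> b\<close>, which is at
        most \<open>B b\<close> and hence at most \<open>B i\<close>.\<close>
      have w3: "within B D (bump i (sem c ?\<tau>))"
        using w2 i2 le lim wt by (intro within_bump) auto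
      have "fst (sem c ?\<tau>) 1 = 1" using w2 by (simp add: within_def)
      then have r3: "runs P ?Q 1 (at (l + 2 + ?n) (sem c ?\<tau>)) (at (l + 3 + ?n) (bump i (sem c ?\<tau>)))"
        using w2 w3 code by (auto intro!: runs_instr[simplified] simp: bump_def)
      have "runs P ?Q (2 + Suc q * (2 + cost B c)) (at l \<sigma>) (at (l + 3 + ?n) (bump i (sem c ?\<tau>)))"
        using runs_mono[OF runs_trans[OF r0 runs_trans[OF r1 runs_trans[OF r2 r3]]],
            of "2 + Suc q * (2 + cost B c)"] by simp
      then show "within B D (st (Suc q)) \<and> fst (st (Suc q)) i = Suc q \<and>
          fst (st (Suc q)) b = fst \<sigma> b \<and>
          runs P ?Q (2 + Suc q * (2 + cost B c)) (at l \<sigma>) (at (l + 3 + ?n) (st (Suc q)))"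
        using w3 i2 b2 wt(2) by (simp add: st(2))
    qed
  qed
  from this[of "fst \<sigma> b"] have w: "within B D (sem (Loop i b c) \<sigma>)"
    and i: "fst (sem (Loop i b c) \<sigma>) i = fst \<sigma> b" "fst (sem (Loop i b c) \<sigma>) b = fst \<sigma> b"
    and r: "runs P ?Q (2 + fst \<sigma> b * (2 + cost B c)) (at l \<sigma>)
      (at (l + 3 + ?n) (sem (Loop i b c) \<sigma>))"
    unfolding st(3) by simp_all
  have "runs P ?Q 1 (at (l + 3 + ?n) (sem (Loop i b c) \<sigma>)) (at (l + 4 + ?n) (sem (Loop i b c) \<sigma>))"
    using w code i by (auto intro!: runs_instr[simplified] simp del: sem.simps)
  note runs_mono[OF runs_trans[OF r this], of "cost B (Loop i b c)"]
  moreover have "2 + fst \<sigma> b * (2 + cost B c) + 1 \<le> cost B (Loop i b c)"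
    using mult_right_mono[OF lim, of "2 + cost B c"] by simp
  moreover have "l + length (compile l (Loop i b c)) = l + 4 + ?n" by simp
  ultimately show ?case using w by (simp only: simp_thms)
qed


section \<open>Extending induced matchings\<close>

definition compatible :: "'a set set \<Rightarrow> 'a set \<Rightarrow> 'a set \<Rightarrow> bool" where
  "compatible E e f \<longleftrightarrow> (\<forall>x\<in>e. \<forall>y\<in>f. {x, y} \<notin> E)"

lemma compatible_sym: "compatible E e f \<Longrightarrow> compatible E f e"
  unfolding compatible_def by (metis insert_commute)

text \<open>If \<open>e = {x, y}\<close> and \<open>x\<close> lies in \<open>f\<close>, then
  \<open>y\<close> and \<open>x\<close> are joined by \<open>e\<close> itself. So the adjacency test
  alone excludes edges that meet and, for \<open>f = e\<close>, repeated edges.\<close>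

lemma not_compatible_meeting:
  assumes "simple_graph V E" "e \<in> E" "f \<in> E" "e \<inter> f \<noteq> {}"
  shows "\<not> compatible E e f"
proof -
  obtain x where x: "x \<in> e" "x \<in> f" using assms(4) by blast
  have "card e = 2" using assms by (auto simp: simple_graph_def)
  then obtain a b where "e = {a, b}" "a \<noteq> b" by (auto simp: card_2_iff)
  then obtain y where "e = {x, y}" using x by auto
  then show ?thesis using x assms(2) by (auto simp: compatible_def insert_commute)
qed

lemma induced_matching_iff_compatible:
  assumes "simple_graph V E"
  shows "induced_matching E M \<longleftrightarrow> M \<subseteq> E \<and> (\<forall>e\<in>M. \<forall>f\<in>M. e \<noteq> f \<longrightarrow> compatible E e f)"
proof -
  have "e \<inter> f = {} \<and> compatible E e f \<longleftrightarrow> compatible E e f" if "e \<in> E" "f \<in> E" for e f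
    using not_compatible_meeting[OF assms that] by blast
  then show ?thesis
    unfolding induced_matching_def compatible_def[symmetric] by (meson subsetD)
qed

lemma induced_matching_insert:
  assumes "simple_graph V E" "induced_matching E M" "e \<in> E" "\<forall>f\<in>M. compatible E f e"
  shows "induced_matching E (insert e M)" "e \<notin> M"
proof -
  show "induced_matching E (insert e M)"
    using assms(2-) compatible_sym unfolding induced_matching_iff_compatible[OF assms(1)] by auto
  have "e \<noteq> {}" using assms(1,3) by (auto simp: simple_graph_def)
  then show "e \<notin> M" using assms not_compatible_meeting[OF assms(1), of e e] by auto
qed

lemma finite_edges: "simple_graph V E \<Longrightarrow> finite E"
  unfolding simple_graph_def by (rule finite_subset[of _ "Pow V"]) auto

text \<open>Testing single edges suffices: any edge of a larger induced matching outside
  \<open>M\<close> is compatible with all of \<open>M\<close>.\<close>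

lemma maximal_induced_matching_iff:
  assumes "simple_graph V E"
  shows "maximal_induced_matching E M \<longleftrightarrow>
    induced_matching E M \<and> \<not> (\<exists>e\<in>E. \<forall>f\<in>M. compatible E f e)"
proof
  assume M: "maximal_induced_matching E M"
  then show "induced_matching E M \<and> \<not> (\<exists>e\<in>E. \<forall>f\<in>M. compatible E f e)"
    using induced_matching_insert[OF assms, of M]
    unfolding maximal_induced_matching_def by blast
next
  assume M: "induced_matching E M \<and> \<not> (\<exists>e\<in>E. \<forall>f\<in>M. compatible E f e)"
  have "M' = M" if M': "induced_matching E M'" "M \<subseteq> M'" for M'
  proof (rule ccontr)
    assume "M' \<noteq> M"
    then obtain e where "e \<in> M'" "e \<notin> M" using M'(2) by blast
    then show False
      using M M' unfolding induced_matching_iff_compatible[OF assms] by (metis subsetD)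
  qed
  then show "maximal_induced_matching E M" using M unfolding maximal_induced_matching_def by blast
qed

lemma maximal_induced_matching_extends:
  assumes "simple_graph V E" "induced_matching E M"
  shows "\<exists>M'. maximal_induced_matching E M' \<and> M \<subseteq> M'"
proof -
  have "finite {M'. induced_matching E M'}"
    by (rule finite_subset[of _ "Pow E"])
       (use finite_edges[OF assms(1)] in \<open>auto simp: induced_matching_def\<close>)
  from finite_has_maximal2[OF this, of M] assms(2) show ?thesis
    unfolding maximal_induced_matching_def by auto
qed

section \<open>A recursive test, relative to a partial matching\<close>

definition completes_to :: "nat \<Rightarrow> 'a set set \<Rightarrow> 'a set set \<Rightarrow> bool" where
  "completes_to k E S \<longleftrightarrow> (\<forall>M. maximal_induced_matching E M \<and> S \<subseteq> M \<longrightarrow> card M = k)"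

text \<open>A maximal \<open>M\<close> above \<open>S\<close> is either \<open>S\<close> itself,
  which happens exactly when no edge is compatible with \<open>S\<close>, or contains some new edge
  \<open>e\<close> and is then covered by \<open>insert e S\<close>.\<close>

lemma completes_to_step:
  assumes G: "simple_graph V E" and S: "induced_matching E S"
  shows "completes_to k E S \<longleftrightarrow>
    (card S = k \<or> (\<exists>e\<in>E. \<forall>f\<in>S. compatible E f e)) \<and>
    (\<forall>e\<in>E. (\<forall>f\<in>S. compatible E f e) \<longrightarrow> completes_to k E (insert e S))"
    (is "?L \<longleftrightarrow> ?R")
proof
  assume ?L
  then show ?R
    using S maximal_induced_matching_iff[OF G, of S] unfolding completes_to_def by blast
next
  assume R: ?R
  have "card M = k" if M: "maximal_induced_matching E M" "S \<subseteq> M" for M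
  proof (cases "M = S")
    case True
    then show ?thesis using R M maximal_induced_matching_iff[OF G] by blast
  next
    case False
    then obtain e where e: "e \<in> M" "e \<notin> S" using M(2) by blast
    have "induced_matching E M" using M(1) by (simp add: maximal_induced_matching_def)
    then have "e \<in> E" "\<forall>f\<in>S. compatible E f e"
      using e M(2) unfolding induced_matching_iff_compatible[OF G] by (blast, metis subsetD)
    then have "completes_to k E (insert e S)" using R by blast
    then show ?thesis using M e unfolding completes_to_def by blast
  qed
  then show ?L unfolding completes_to_def by blast
qed

text \<open>The base case of the recursion: an oversized matching lies in a maximal one, which is at
  least as large.\<close>

lemma not_completes_to_smaller:
  assumes "simple_graph V E" "induced_matching E S" "card S > k"
  shows "\<not> completes_to k E S"
proof -
  obtain M where M: "maximal_induced_matching E M" "S \<subseteq> M"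
    using maximal_induced_matching_extends[OF assms(1,2)] by blast
  then have "M \<subseteq> E" by (simp add: maximal_induced_matching_def induced_matching_def)
  then have "finite M" using finite_edges[OF assms(1)] finite_subset by blast
  then have "card M > k" using card_mono[OF _ M(2)] assms(3) by auto
  then show ?thesis using M unfolding completes_to_def by auto
qed

definition edge :: "nat \<times> nat \<Rightarrow> nat set" where
  "edge p = {fst p, snd p}"

text \<open>The number counts down from \<open>k + 1\<close>: at \<open>Suc r\<close>,
  \<open>r\<close> edges are missing from size \<open>k\<close>, so \<open>r = 0\<close> means that
  being maximal is allowed; at \<open>0\<close>, \<open>k + 1\<close> edges have been chosen and the
  graph is refuted.\<close>

fun accepts :: "nat set set \<Rightarrow> (nat \<times> nat) list \<Rightarrow> nat \<Rightarrow> (nat \<times> nat) list \<Rightarrow> bool" where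
  "accepts E es 0 xs = False"
| "accepts E es (Suc r) xs =
     ((r = 0 \<or> (\<exists>e\<in>set es. \<forall>x\<in>set xs. compatible E (edge x) (edge e))) \<and>
      (\<forall>e\<in>set es. (\<forall>x\<in>set xs. compatible E (edge x) (edge e)) \<longrightarrow> accepts E es r (xs @ [e])))"

lemma accepts_iff_completes_to:
  assumes G: "simple_graph V E" and es: "edge ` set es = E"
    and "induced_matching E (edge ` set xs)" "card (edge ` set xs) + r = Suc k"
  shows "accepts E es r xs \<longleftrightarrow> completes_to k E (edge ` set xs)"
  using assms(3,4)
proof (induction r arbitrary: xs)
  case 0
  then show ?case using not_completes_to_smaller[OF G] by simp
next
  case (Suc r)
  let ?S = "edge ` set xs"
  have fin: "finite ?S" by simp
  \<comment> \<open>A compatible edge is new, so the cardinality rises by one while the counter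
    drops by one.\<close>
  have "accepts E es r (xs @ [e]) \<longleftrightarrow> completes_to k E (insert (edge e) ?S)"
    if "e \<in> set es" "\<forall>x\<in>set xs. compatible E (edge x) (edge e)" for e
    using Suc.IH[of "xs @ [e]"] induced_matching_insert[OF G Suc.prems(1), of "edge e"]
      that es Suc.prems(2) fin by auto
  then have "accepts E es (Suc r) xs \<longleftrightarrow>
    (r = 0 \<or> (\<exists>e\<in>E. \<forall>f\<in>?S. compatible E f e)) \<and>
    (\<forall>e\<in>E. (\<forall>f\<in>?S. compatible E f e) \<longrightarrow> completes_to k E (insert e ?S))"
    unfolding accepts.simps es[symmetric] by auto
  moreover have "r = 0 \<longleftrightarrow> card ?S = k" using Suc.prems(2) by linarith
  ultimately show ?case using completes_to_step[OF G Suc.prems(1)] by simp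
qed

lemma accepts_iff_well_indumatched:
  assumes "simple_graph V E" "edge ` set es = E"
  shows "accepts E es (Suc k) [] \<longleftrightarrow> well_indumatched k E"
  using accepts_iff_completes_to[OF assms, of "[]" "Suc k" k]
  by (simp add: induced_matching_def completes_to_def well_indumatched_def)


section \<open>Searching the induced matchings\<close>

text \<open>
  Registers: \<open>0\<close> and \<open>1\<close> hold these constants, \<open>2\<close> holds \<open>n\<close>, \<open>3\<close> holds \<open>n\<^sup>2\<close>, \<open>4\<close> holds the
  number of edges listed so far, \<open>5\<close> is set to \<open>1\<close> on rejection, \<open>6\<close> to \<open>11\<close> are
  scratch, \<open>12\<close> and \<open>13\<close> are the loop counters of the extraction of the edge list, which is
  stored behind the adjacency matrix.  Nesting level \<open>j\<close> of the search owns four registers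
  from \<open>14 + 4 * j\<close> on: its position in the edge list, the two endpoints of the edge there, and a flag
  telling whether the matching chosen on the lower levels has been extended.
\<close>

definition lookup :: "nat \<Rightarrow> nat \<Rightarrow> com" where
  "lookup a b = Basic (Mul 7 a 2) ;; Basic (Add 8 7 b) ;; Basic (Add 9 8 1) ;; Basic (Load 11 9)"

text \<open>\<open>i\<close> is a register holding a list position \<open>q\<close>; the cells of
  that entry, \<open>2 * q + n * n + 1\<close> and the next one, end up in registers
  \<open>9\<close> and \<open>10\<close>. Each sum gets a fresh register because
  \<open>typed\<close> wants room for both operands.\<close>

definition locate :: "nat \<Rightarrow> com" where
  "locate i = Basic (Add 7 i i) ;; Basic (Add 8 7 3) ;; Basic (Add 9 8 1) ;; Basic (Add 10 9 1)"

definition probe :: "nat \<Rightarrow> nat \<Rightarrow> com" where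
  "probe a b = lookup a b ;; Basic (Sub 6 6 11)"

text \<open>The comparisons are unrolled into program text, since registers can be addressed only by
  constants. \<open>j\<close> is the level under test, \<open>i\<close> the number of levels it is
  compared with.\<close>

fun check :: "nat \<Rightarrow> nat \<Rightarrow> com" where
  "check j 0 = Basic (Const 6 1)"
| "check j (Suc i) = check j i ;;
     probe (15 + 4 * i) (15 + 4 * j) ;; probe (15 + 4 * i) (16 + 4 * j) ;;
     probe (16 + 4 * i) (15 + 4 * j) ;; probe (16 + 4 * i) (16 + 4 * j)"

definition fetch :: "nat \<Rightarrow> com" where
  "fetch j = locate (14 + 4 * j) ;; Basic (Load (15 + 4 * j) 9) ;; Basic (Load (16 + 4 * j) 10)"

text \<open>The flag of level \<open>j\<close> starts at \<open>1\<close> exactly if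
  \<open>r = 0\<close>, when no extension is required. A flag still \<open>0\<close> after the loop
  causes rejection. Rejection does not stop the search.\<close>

fun search :: "nat \<Rightarrow> nat \<Rightarrow> com" where
  "search j 0 = Basic (Const 5 1)"
| "search j (Suc r) =
     Basic (Const (17 + 4 * j) (if r = 0 then 1 else 0)) ;;
     Loop (14 + 4 * j) 4
       (fetch j ;; check j j ;;
        When 0 6 (Basic (Const (17 + 4 * j) 1) ;; search (Suc j) r)) ;;
     When (17 + 4 * j) 1 (Basic (Const 5 1))"

text \<open>The test of \<open>12\<close> against \<open>13\<close> keeps one orientation of each
  edge. The guard of \<open>Incr 4 3\<close> always holds; it is there to bound register
  \<open>4\<close> syntactically.\<close>

definition prep :: com where
  "prep = Basic (Load 2 0) ;; Basic (Mul 3 2 2) ;;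
     Loop 12 2 (Loop 13 2 (When 12 13 (lookup 12 13 ;;
       When 0 11 (locate 4 ;; Basic (Store 9 12) ;; Basic (Store 10 13) ;; Incr 4 3))))"

section \<open>Correctness of the search\<close>

lemma writes_check: "writes (check j i) \<subseteq> {6..11}"
  by (induction i) (auto simp: probe_def lookup_def)

lemma stores_check: "\<not> stores (check j i)"
  by (induction i) (auto simp: probe_def lookup_def)

lemma writes_fetch: "writes (fetch j) = {7, 8, 9, 10, 15 + 4 * j, 16 + 4 * j}"
  by (auto simp: fetch_def locate_def)

lemma stores_fetch: "\<not> stores (fetch j)"
  by (auto simp: fetch_def locate_def)

text \<open>Nested levels write only the rejection flag, scratch registers and registers of levels
  from \<open>j\<close> on, so the choices, counters and flags of lower levels survive a recursive
  search.\<close>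

lemma writes_search: "writes (search j r) \<subseteq> {5..11} \<union> {14 + 4 * j..}"
proof (induction r arbitrary: j)
  case (Suc r)
  have "writes (search (Suc j) r) \<subseteq> {5..11} \<union> {14 + 4 * j..}" using Suc[of "Suc j"] by force
  moreover have "writes (check j j) \<subseteq> {5..11} \<union> {14 + 4 * j..}"
    using writes_check[of j j] by force
  ultimately show ?case by (auto simp: writes_fetch)
qed simp

lemma stores_search: "\<not> stores (search j r)"
  by (induction r arbitrary: j) (auto simp: stores_fetch stores_check)

text \<open>The list \<open>es\<close> is a parameter, so that the same predicate describes the
  partial list during extraction.\<close>

definition ready :: "nat \<Rightarrow> nat set set \<Rightarrow> (nat \<times> nat) list \<Rightarrow> store \<Rightarrow> bool" where
  "ready n E es \<sigma> \<longleftrightarrow> fst \<sigma> 0 = 0 \<and> fst \<sigma> 1 = 1 \<and> fst \<sigma> 2 = n \<and> fst \<sigma> 3 = n * n \<and>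
     fst \<sigma> 4 = length es \<and>
     (\<forall>u<n. \<forall>v<n. snd \<sigma> (u * n + v + 1) = of_bool ({u, v} \<in> E)) \<and>
     (\<forall>q<length es. snd \<sigma> (2 * q + n * n + 1) = fst (es ! q) \<and>
        snd \<sigma> (2 * q + n * n + 2) = snd (es ! q))"

definition level :: "store \<Rightarrow> nat \<Rightarrow> nat \<times> nat" where
  "level \<sigma> i = (fst \<sigma> (15 + 4 * i), fst \<sigma> (16 + 4 * i))"

lemma ready_cong:
  assumes "ready n E es \<sigma>" "\<And>r. r < 5 \<Longrightarrow> fst \<tau> r = fst \<sigma> r" "snd \<tau> = snd \<sigma>"
  shows "ready n E es \<tau>"
  using assms by (simp add: ready_def)

lemma sem_probe:
  assumes "ready n E es \<sigma>" "fst \<sigma> a < n" "fst \<sigma> b < n" "a \<ge> 12" "b \<ge> 12"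
  shows "fst (sem (probe a b) \<sigma>) 6 = fst \<sigma> 6 - of_bool ({fst \<sigma> a, fst \<sigma> b} \<in> E)"
  using assms by (auto simp: probe_def lookup_def ready_def)

lemma sem_check:
  assumes \<sigma>: "ready n E es \<sigma>"
    and less: "\<And>i'. i' < i \<or> i' = j \<Longrightarrow> fst (level \<sigma> i') < n \<and> snd (level \<sigma> i') < n"
  shows "fst (sem (check j i) \<sigma>) 6 =
    of_bool (\<forall>i'<i. compatible E (edge (level \<sigma> i')) (edge (level \<sigma> j)))"
  using less
proof (induction i)
  case (Suc i)
  define \<tau> where "\<tau> = sem (check j i) \<sigma>"
  have w: "writes (probe a b) \<subseteq> {6..11}" "\<not> stores (probe a b)" for a b
    by (auto simp: probe_def lookup_def)
  have keep: "fst (sem (probe a b) \<rho>) r = fst \<rho> r" if "r < 5 \<or> r \<ge> 12" for a b r \<rho>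
    using w(1)[of a b] that by (intro sem_unwritten) force
  have \<tau>: "fst \<tau> r = fst \<sigma> r" if "r < 5 \<or> r \<ge> 12" for r
    unfolding \<tau>_def using writes_check[of j i] that by (intro sem_unwritten) force
  have ready: "ready n E es \<tau>"
    by (rule ready_cong[OF \<sigma>]) (use \<tau> in \<open>auto simp: \<tau>_def sem_no_stores[OF stores_check]\<close>)
  have ready': "ready n E es (sem (probe a b) \<rho>)" if "ready n E es \<rho>" for a b \<rho>
    by (rule ready_cong[OF that]) (auto simp: keep sem_no_stores[OF w(2)])
  have IH: "fst \<tau> 6 = of_bool (\<forall>i'<i. compatible E (edge (level \<sigma> i')) (edge (level \<sigma> j)))"
    unfolding \<tau>_def by (rule Suc.IH) (use Suc.prems in auto)
  have le: "fst \<sigma> (15 + 4 * i) < n" "fst \<sigma> (16 + 4 * i) < n"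
    "fst \<sigma> (15 + 4 * j) < n" "fst \<sigma> (16 + 4 * j) < n"
    using Suc.prems[of i] Suc.prems[of j] by (auto simp: level_def)
  have "fst (sem (check j (Suc i)) \<sigma>) 6 = fst \<tau> 6 -
      of_bool ({fst \<sigma> (15 + 4 * i), fst \<sigma> (15 + 4 * j)} \<in> E) -
      of_bool ({fst \<sigma> (15 + 4 * i), fst \<sigma> (16 + 4 * j)} \<in> E) -
      of_bool ({fst \<sigma> (16 + 4 * i), fst \<sigma> (15 + 4 * j)} \<in> E) -
      of_bool ({fst \<sigma> (16 + 4 * i), fst \<sigma> (16 + 4 * j)} \<in> E)"
    by (simp add: \<tau>_def[symmetric] sem_probe[where n = n and E = E and es = es] ready ready' keep \<tau> le)
  then show ?case
    unfolding IH by (auto simp: compatible_def edge_def level_def less_Suc_eq)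
qed simp

lemma sem_fetch:
  assumes "ready n E es \<sigma>" "fst \<sigma> (14 + 4 * j) < length es"
  shows "level (sem (fetch j) \<sigma>) j = es ! fst \<sigma> (14 + 4 * j)"
  using assms by (auto simp: fetch_def locate_def level_def ready_def prod_eq_iff mult_2)

text \<open>On acceptance register \<open>5\<close> keeps its old value rather than becoming
  \<open>0\<close>; this lets the verdicts of successive candidates accumulate.\<close>

lemma sem_search:
  assumes es: "\<And>e. e \<in> set es \<Longrightarrow> fst e < n \<and> snd e < n"
    and "ready n E es \<sigma>" "set xs \<subseteq> set es" "map (level \<sigma>) [0..<length xs] = xs"
  shows "fst (sem (search (length xs) r) \<sigma>) 5 = (if accepts E es r xs then fst \<sigma> 5 else 1)"
  using assms(2-)
proof (induction r arbitrary: xs \<sigma>)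
  case (Suc r)
  define j where "j = length xs"
  define c where "c = fetch j ;; check j j ;;
    When 0 6 (Basic (Const (17 + 4 * j) 1) ;; search (Suc j) r)"
  define ext where "ext e \<longleftrightarrow> (\<forall>x\<in>set xs. compatible E (edge x) (edge e))" for e
  \<comment> \<open>The two conjuncts of \<open>accepts\<close>, restricted to the first
    \<open>q\<close> candidates: register \<open>5\<close> records a failed branch, the level flag
    an existing extension.\<close>
  define I where "I q \<tau> \<longleftrightarrow> ready n E es \<tau> \<and> map (level \<tau>) [0..<j] = xs \<and>
      fst \<tau> 5 = (if \<forall>e\<in>set (take q es). ext e \<longrightarrow> accepts E es r (xs @ [e]) then fst \<sigma> 5 else 1) \<and>
      fst \<tau> (17 + 4 * j) = of_bool (r = 0 \<or> (\<exists>e\<in>set (take q es). ext e))" for q \<tau>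
  define \<sigma>1 where "\<sigma>1 = sem (Basic (Const (17 + 4 * j) (if r = 0 then 1 else 0))) \<sigma>"
  have step: "I (Suc q) (bump (14 + 4 * j) (sem c \<tau>))"
    if I: "I q \<tau>" and q: "q < length es" and i: "fst \<tau> (14 + 4 * j) = q" for q \<tau>
  proof -
    let ?e = "es ! q"
    define \<tau>1 where "\<tau>1 = sem (fetch j) \<tau>"
    define \<tau>2 where "\<tau>2 = sem (check j j) \<tau>1"
    have e: "?e \<in> set es" using q by simp
    have \<tau>: "ready n E es \<tau>" "map (level \<tau>) [0..<j] = xs" using I by (auto simp: I_def)
    have fetch: "fst \<tau>1 r = fst \<tau> r" if "r \<notin> {7, 8, 9, 10, 15 + 4 * j, 16 + 4 * j}" for r
      unfolding \<tau>1_def by (rule sem_unwritten) (use that in \<open>simp add: writes_fetch\<close>)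
    have check: "fst \<tau>2 r = fst \<tau>1 r" if "r < 6 \<or> r > 11" for r
      unfolding \<tau>2_def by (rule sem_unwritten) (use that writes_check[of j j] in force)
    have mem: "snd \<tau>1 = snd \<tau>" "snd \<tau>2 = snd \<tau>"
      by (simp_all add: \<tau>1_def \<tau>2_def sem_no_stores stores_fetch stores_check)
    have ready1: "ready n E es \<tau>1"
      by (rule ready_cong[OF \<tau>(1)]) (auto simp: fetch mem)
    have ready2: "ready n E es \<tau>2"
      by (rule ready_cong[OF ready1]) (auto simp: check mem)
    have lev: "level \<tau>1 i' = level \<tau> i'" if "i' < j" for i'
      using that by (auto simp: level_def fetch)
    have lev_xs: "level \<tau> i' = xs ! i'" if "i' < j" for i'
      using arg_cong[OF \<tau>(2), of "\<lambda>ys. ys ! i'"] that by simp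
    have lev_j: "level \<tau>1 j = ?e"
      using sem_fetch[OF \<tau>(1), of j] i q by (simp add: \<tau>1_def)
    have "fst (level \<tau>1 i') < n \<and> snd (level \<tau>1 i') < n" if "i' < j \<or> i' = j" for i'
    proof (cases "i' = j")
      case False
      then have "level \<tau>1 i' \<in> set es"
        using that lev lev_xs Suc.prems(2) by (auto simp: j_def)
      then show ?thesis using es by blast
    qed (use lev_j e es in auto)
    from sem_check[OF ready1 this]
    have "fst \<tau>2 6 = of_bool (\<forall>i'<j. compatible E (edge (level \<tau>1 i')) (edge (level \<tau>1 j)))"
      unfolding \<tau>2_def by blast
    also have "(\<forall>i'<j. compatible E (edge (level \<tau>1 i')) (edge (level \<tau>1 j))) \<longleftrightarrow> ext ?e"
      by (simp add: lev lev_j lev_xs ext_def all_set_conv_all_nth j_def[symmetric])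
    finally have flag: "fst \<tau>2 6 = of_bool (ext ?e)" .
    have take: "take (Suc q) es = take q es @ [?e]" using q by (simp add: take_Suc_conv_app_nth)
    have sem_c: "sem c \<tau> = (if ext ?e
        then sem (search (Suc j) r) ((fst \<tau>2)(17 + 4 * j := 1), snd \<tau>2) else \<tau>2)"
      using flag ready2 by (simp add: c_def \<tau>1_def[symmetric] \<tau>2_def[symmetric] ready_def)
    show ?thesis
    proof (cases "ext ?e")
      case False
      then have sem_c: "sem c \<tau> = \<tau>2" using sem_c by simp
      have "map (level (bump (14 + 4 * j) \<tau>2)) [0..<j] = map (level \<tau>) [0..<j]"
        by (auto simp: level_def check fetch)
      moreover have "ready n E es (bump (14 + 4 * j) \<tau>2)"
        by (rule ready_cong[OF ready2]) auto
      ultimately show ?thesis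
        using I False unfolding sem_c I_def take by (auto simp: check fetch)
    next
      case True
      define \<tau>3 where "\<tau>3 = ((fst \<tau>2)(17 + 4 * j := 1), snd \<tau>2)"
      define \<tau>4 where "\<tau>4 = sem (search (Suc j) r) \<tau>3"
      have sem_c: "sem c \<tau> = \<tau>4" using True sem_c by (simp add: \<tau>3_def \<tau>4_def)
      have ready3: "ready n E es \<tau>3"
        by (rule ready_cong[OF ready2]) (auto simp: \<tau>3_def)
      have lev3: "level \<tau>3 i' = level \<tau>1 i'" if "i' \<le> j" for i'
        using that by (auto simp: level_def \<tau>3_def check)
      have "map (level \<tau>3) [0..<length (xs @ [?e])] = xs @ [?e]"
        by (rule nth_equalityI) (auto simp: lev3 lev lev_xs lev_j nth_append j_def[symmetric] less_Suc_eq)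
      from Suc.IH[OF ready3 _ this] Suc.prems(2) e
      have bad: "fst \<tau>4 5 = (if accepts E es r (xs @ [?e]) then fst \<tau>3 5 else 1)"
        by (simp add: \<tau>4_def j_def)
      \<comment> \<open>The recursive search owns registers from \<open>18 + 4 * j\<close> on, so
        all four registers of level \<open>j\<close> are preserved.\<close>
      have keep: "fst \<tau>4 s = fst \<tau>3 s" if "s < 5 \<or> 11 < s \<and> s < 18 + 4 * j" for s
        unfolding \<tau>4_def using that writes_search[of "Suc j" r] by (intro sem_unwritten) force
      have mem4: "snd \<tau>4 = snd \<tau>3" unfolding \<tau>4_def by (rule sem_no_stores[OF stores_search])
      have "map (level (bump (14 + 4 * j) \<tau>4)) [0..<j] = map (level \<tau>1) [0..<j]"
        by (auto simp: level_def keep \<tau>3_def check)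
      also have "\<dots> = xs" using lev by (subst \<tau>(2)[symmetric]) simp
      finally have "map (level (bump (14 + 4 * j) \<tau>4)) [0..<j] = xs" .
      moreover have "ready n E es (bump (14 + 4 * j) \<tau>4)"
        by (rule ready_cong[OF ready3]) (auto simp: keep mem4)
      moreover have "fst \<tau>3 5 = fst \<tau> 5" by (simp add: \<tau>3_def check fetch)
      ultimately show ?thesis
        using I True bad unfolding sem_c I_def take by (auto simp: keep \<tau>3_def)
    qed
  qed
  have "writes (search (Suc j) r) \<subseteq> {5..11} \<union> {18 + 4 * j..}"
    using writes_search[of "Suc j" r] by simp
  then have notin: "14 + 4 * j \<notin> writes c"
    using writes_check[of j j] by (force simp: c_def writes_fetch)
  have "map (level \<sigma>1) [0..<j] = map (level \<sigma>) [0..<j]"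
    by (auto simp: \<sigma>1_def level_def)
  then have \<sigma>1: "ready n E es \<sigma>1" "map (level \<sigma>1) [0..<j] = xs"
    using ready_cong[OF Suc.prems(1), of \<sigma>1] Suc.prems(3)
    by (auto simp: \<sigma>1_def j_def[symmetric])
  have "I 0 ((fst \<sigma>1)(14 + 4 * j := 0), snd \<sigma>1)"
    using \<sigma>1 ready_cong[OF \<sigma>1(1), of "((fst \<sigma>1)(14 + 4 * j := 0), snd \<sigma>1)"]
    by (auto simp: I_def level_def \<sigma>1_def)
  then have "I (length es) (sem (Loop (14 + 4 * j) 4 c) \<sigma>1)"
    using \<sigma>1(1) step by - (rule sem_Loop_invariant[where I = I, OF notin], auto simp: ready_def)
  moreover have "sem (search (length xs) (Suc r)) \<sigma> =
      sem (When (17 + 4 * j) 1 (Basic (Const 5 1))) (sem (Loop (14 + 4 * j) 4 c) \<sigma>1)"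
    by (simp add: c_def \<sigma>1_def j_def)
  ultimately show ?case
    by (auto simp: I_def ready_def ext_def simp del: sem.simps(5))
qed simp


section \<open>Extracting the edge list\<close>

text \<open>\<open>List.product\<close> enumerates the pairs in the order in which the nested loops
  of \<open>prep\<close> visit them.\<close>

definition edge_list :: "nat \<Rightarrow> nat set set \<Rightarrow> (nat \<times> nat) list" where
  "edge_list n E = filter (\<lambda>p. fst p < snd p \<and> edge p \<in> E) (List.product [0..<n] [0..<n])"

lemma edge_list_less: "e \<in> set (edge_list n E) \<Longrightarrow> fst e < n \<and> snd e < n"
  by (auto simp: edge_list_def)

lemma edge_image_edge_list:
  assumes "simple_graph {..<n} E"
  shows "edge ` set (edge_list n E) = E"
proof -
  have "e \<in> edge ` set (edge_list n E)" if e: "e \<in> E" for e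
  proof -
    have "card e = 2" "e \<subseteq> {..<n}" using assms e by (auto simp: simple_graph_def)
    then obtain a b where ab: "e = {a, b}" "a \<noteq> b" "a < n" "b < n" by (auto simp: card_2_iff)
    then have "(min a b, max a b) \<in> set (edge_list n E)" "edge (min a b, max a b) = e"
      using e by (auto simp: edge_list_def edge_def min_def max_def insert_commute)
    then show ?thesis by (metis imageI)
  qed
  moreover have "edge ` set (edge_list n E) \<subseteq> E" by (auto simp: edge_list_def)
  ultimately show ?thesis by blast
qed

text \<open>Keeping only increasing pairs makes \<open>edge\<close> injective on the list, so
  register \<open>4\<close> finally holds the exact number of edges.\<close>

lemma length_edge_list:
  assumes "simple_graph {..<n} E"
  shows "length (edge_list n E) = card E"
proof -
  have "distinct (edge_list n E)" by (simp add: edge_list_def distinct_product)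
  moreover have "inj_on edge (set (edge_list n E))"
    by (auto simp: inj_on_def edge_list_def edge_def doubleton_eq_iff)
  ultimately show ?thesis
    using edge_image_edge_list[OF assms] by (metis card_image distinct_card)
qed

lemma card_edges_le:
  assumes "simple_graph {..<n} E"
  shows "card E \<le> n * n"
proof -
  have "length (edge_list n E) \<le> length (List.product [0..<n] [0..<n])"
    unfolding edge_list_def by (rule length_filter_le)
  then show ?thesis using length_edge_list[OF assms] by simp
qed

definition gathered :: "nat \<Rightarrow> nat set set \<Rightarrow> (nat \<times> nat) list \<Rightarrow> store \<Rightarrow> bool" where
  "gathered n E es \<sigma> \<longleftrightarrow> ready n E es \<sigma> \<and> fst \<sigma> 5 = 0"

lemma gathered_cong:
  assumes "gathered n E es \<sigma>" "\<And>r. r < 6 \<Longrightarrow> fst \<tau> r = fst \<sigma> r" "snd \<tau> = snd \<sigma>"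
  shows "gathered n E es \<tau>"
  using assms by (auto simp: gathered_def intro: ready_cong)

text \<open>Serves twice: matrix cells lie before the edge list, and fewer than \<open>n * n\<close>
  pairs precede \<open>(u, v)\<close>, which makes the guard of \<open>Incr 4 3\<close>
  hold.\<close>

lemma matrix_index_less: "u < n \<Longrightarrow> v < n \<Longrightarrow> u * n + v < n * (n::nat)"
proof -
  assume "u < n" "v < n"
  then have "Suc u * n \<le> n * n" by (intro mult_le_mono1) simp
  then show ?thesis using \<open>v < n\<close> by simp
qed

lemma gathered_append:
  assumes g: "gathered n E es \<sigma>" and u: "fst \<sigma> 12 = u" "u < n" and v: "fst \<sigma> 13 = v" "v < n"
    and len: "length es < n * n"
  shows "gathered n E (es @ filter (\<lambda>p. fst p < snd p \<and> edge p \<in> E) [(u, v)])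
    (sem (When 12 13 (lookup 12 13 ;;
       When 0 11 (locate 4 ;; Basic (Store 9 12) ;; Basic (Store 10 13) ;; Incr 4 3))) \<sigma>)"
    (is "gathered n E ?es' (sem ?c \<sigma>)")
proof (cases "u < v")
  case True
  define \<tau> where "\<tau> = sem (lookup 12 13) \<sigma>"
  have \<tau>: "gathered n E es \<tau>" "fst \<tau> 12 = u" "fst \<tau> 13 = v"
    using gathered_cong[OF g, of \<tau>] u v by (auto simp: \<tau>_def lookup_def)
  have flag: "fst \<tau> 11 = of_bool ({u, v} \<in> E)" "fst \<tau> 0 = 0"
    using g u v by (auto simp: \<tau>_def lookup_def gathered_def ready_def)
  show ?thesis
  proof (cases "{u, v} \<in> E")
    case False
    then have "sem ?c \<sigma> = \<tau>" using True u v flag by (simp add: \<tau>_def[symmetric])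
    then show ?thesis using False \<tau>(1) by (simp add: edge_def)
  next
    case edge: True
    let ?a = "2 * length es + n * n + 1"
    have regs: "fst \<tau> 1 = 1" "fst \<tau> 3 = n * n" "fst \<tau> 4 = length es"
      using \<tau>(1) by (auto simp: gathered_def ready_def)
    define \<rho> where "\<rho> = sem ?c \<sigma>"
    have \<rho>: "\<rho> = sem (locate 4 ;; Basic (Store 9 12) ;; Basic (Store 10 13) ;; Incr 4 3) \<tau>"
      using True u v flag edge by (simp add: \<rho>_def \<tau>_def[symmetric])
    have mem: "snd \<rho> = (snd \<tau>)(?a := u, ?a + 1 := v)"
      using regs \<tau> len by (simp add: \<rho> locate_def mult_2)
    have reg: "fst \<rho> 4 = length es + 1" "\<And>r. r < 4 \<or> r = 5 \<Longrightarrow> fst \<rho> r = fst \<tau> r"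
      using regs len by (auto simp: \<rho> locate_def)
    have "?es' = es @ [(u, v)]" using True edge by (simp add: edge_def)
    \<comment> \<open>Both stores go to addresses above \<open>n * n\<close>, so the matrix is
      intact.\<close>
    moreover have "snd \<rho> (x * n + y + 1) = of_bool ({x, y} \<in> E)" if "x < n" "y < n" for x y
      using matrix_index_less[OF that] \<tau>(1) that by (simp add: mem gathered_def ready_def)
    ultimately show ?thesis
      using \<tau>(1) reg mem unfolding \<rho>_def[symmetric]
      by (auto simp: gathered_def ready_def nth_append less_Suc_eq)
  qed
qed (use g u v in simp)

lemma sem_prep:
  "gathered n E (edge_list n E) (sem prep ((\<lambda>_. 0)(1 := 1), mem (adjacency_input n E)))"
proof -
  define body where "body = When 12 13 (lookup 12 13 ;;
    When 0 11 (locate 4 ;; Basic (Store 9 12) ;; Basic (Store 10 13) ;; Incr 4 3))"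
  define F where "F = filter (\<lambda>p. fst p < snd p \<and> edge p \<in> E)"
  define \<sigma> where "\<sigma> = sem (Basic (Load 2 0) ;; Basic (Mul 3 2 2))
    ((\<lambda>_. 0)(1 := 1), mem (adjacency_input n E))"
  have w: "12 \<notin> writes body" "13 \<notin> writes body"
    by (auto simp: body_def lookup_def locate_def)
  have "mem (adjacency_input n E) (u * n + v + 1) = of_bool ({u, v} \<in> E)" if "u < n" "v < n" for u v
    using matrix_index_less[OF that] that by (simp add: adjacency_input_def Suc_le_eq)
  then have \<sigma>: "gathered n E [] \<sigma>"
    by (auto simp: \<sigma>_def gathered_def ready_def) (auto simp: adjacency_input_def)
  have row: "gathered n E (F (List.product [0..<u] [0..<n] @ map (Pair u) [0..<n]))
      (sem (Loop 13 2 body) \<tau>)"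
    if \<tau>: "gathered n E (F (List.product [0..<u] [0..<n])) \<tau>" "fst \<tau> 12 = u" "u < n" for u \<tau>
  proof -
    define I where "I v \<rho> \<longleftrightarrow> fst \<rho> 12 = u \<and>
      gathered n E (F (List.product [0..<u] [0..<n] @ map (Pair u) [0..<v])) \<rho>" for v \<rho>
    have "I n (sem (Loop 13 2 body) \<tau>)"
    proof (rule sem_Loop_invariant)
      show "13 \<notin> writes body" by (rule w)
      show "fst \<tau> 2 = n" using \<tau>(1) by (simp add: gathered_def ready_def)
      show "I 0 ((fst \<tau>)(13 := 0), snd \<tau>)"
        using \<tau> gathered_cong[OF \<tau>(1), of "((fst \<tau>)(13 := 0), snd \<tau>)"] by (simp add: I_def)
    next
      fix v \<rho>
      assume \<rho>: "I v \<rho>" "v < n" "fst \<rho> 13 = v"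
      let ?L = "List.product [0..<u] [0..<n] @ map (Pair u) [0..<v]"
      \<comment> \<open>The pairs visited so far number \<open>u * n + v\<close>, and the filter
        only shortens their list.\<close>
      have "length (F ?L) \<le> length ?L" unfolding F_def by (rule length_filter_le)
      also have "\<dots> < n * n" using matrix_index_less[OF \<tau>(3) \<rho>(2)] by simp
      finally have "gathered n E (F ?L @ F [(u, v)]) (sem body \<rho>)"
        using gathered_append[of n E "F ?L" \<rho> u v] \<rho> \<tau>(3) by (simp add: I_def F_def body_def)
      then have "gathered n E (F ?L @ F [(u, v)]) (bump 13 (sem body \<rho>))"
        by (rule gathered_cong) auto
      moreover have "F ?L @ F [(u, v)] = F (List.product [0..<u] [0..<n] @ map (Pair u) [0..<Suc v])"
        by (simp add: F_def)
      ultimately show "I (Suc v) (bump 13 (sem body \<rho>))"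
        using \<rho>(1) sem_unwritten[OF w(1)] by (simp add: I_def)
    qed
    then show ?thesis by (simp add: I_def)
  qed
  define J where "J u \<rho> \<longleftrightarrow> gathered n E (F (List.product [0..<u] [0..<n])) \<rho>" for u \<rho>
  have "J n (sem (Loop 12 2 (Loop 13 2 body)) \<sigma>)"
  proof (rule sem_Loop_invariant)
    show "12 \<notin> writes (Loop 13 2 body)" using w by simp
    show "fst \<sigma> 2 = n" using \<sigma> by (simp add: gathered_def ready_def)
    show "J 0 ((fst \<sigma>)(12 := 0), snd \<sigma>)"
      using gathered_cong[OF \<sigma>, of "((fst \<sigma>)(12 := 0), snd \<sigma>)"] by (simp add: J_def F_def)
  next
    fix u \<rho>
    assume "J u \<rho>" "u < n" "fst \<rho> 12 = u"
    then have "gathered n E (F (List.product [0..<u] [0..<n] @ map (Pair u) [0..<n]))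
      (bump 12 (sem (Loop 13 2 body) \<rho>))"
      by (intro gathered_cong[OF row]) (auto simp: J_def)
    then show "J (Suc u) (bump 12 (sem (Loop 13 2 body) \<rho>))"
      by (simp add: J_def product_concat_map)
  qed
  then show ?thesis
    by (simp add: J_def F_def edge_list_def prep_def \<sigma>_def body_def)
qed


section \<open>The program\<close>

text \<open>Exponents rise along the scratch registers \<open>7\<close> to \<open>10\<close>,
  leaving room for each arithmetic result; the largest, \<open>6\<close>, gives the final word size.
  Register \<open>4\<close> has its own bound \<open>m\<close> because it limits the search loops,
  whose cost must depend on the number of edges.\<close>

definition bound :: "nat \<Rightarrow> nat \<Rightarrow> nat \<Rightarrow> nat" where
  "bound x m r =
     (if r = 4 then m
      else x ^ (if r = 7 then 3 else if r = 8 then 4 else if r = 9 then 5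
        else if r = 10 then 6 else if r = 3 \<or> r \<ge> 14 then 2 else 1))"

lemma bound_cong: "r \<noteq> 4 \<Longrightarrow> bound x m r = bound x m' r"
  by (simp add: bound_def)

text \<open>One more factor \<open>x\<close> absorbs the \<open>2\<close> of the sum; hence bounds
  are powers of \<open>n + 2\<close>, never of \<open>0\<close> or \<open>1\<close>.\<close>

lemma power_add_le:
  fixes x :: nat
  assumes "2 \<le> x" "i < l" "j < l"
  shows "x ^ i + x ^ j \<le> x ^ l"
proof -
  obtain l' where l: "l = Suc l'" using assms by (cases l) auto
  have "x ^ i \<le> x ^ l'" "x ^ j \<le> x ^ l'"
    using assms l by (auto intro: power_increasing)
  then have "x ^ i + x ^ j \<le> 2 * x ^ l'" by simp
  also have "\<dots> \<le> x ^ l" using assms(1) by (simp add: l)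
  finally show ?thesis .
qed

lemma bound_le:
  assumes "2 \<le> x" "m \<le> x\<^sup>2"
  shows "bound x m r \<le> x ^ 6" and "r = 4 \<or> r \<ge> 12 \<Longrightarrow> bound x m r \<le> x\<^sup>2"
proof -
  have "x ^ l \<le> x ^ 6" if "l \<le> 6" for l using assms(1) that by (intro power_increasing) auto
  then show "bound x m r \<le> x ^ 6" using assms(2) le_trans[of m "x\<^sup>2" "x ^ 6"] by (simp add: bound_def)
  show "bound x m r \<le> x\<^sup>2" if "r = 4 \<or> r \<ge> 12"
    using that assms self_le_power[of x 2] by (auto simp: bound_def)
qed

lemma typed_locate:
  assumes "2 \<le> x" "m \<le> x\<^sup>2" "i = 4 \<or> i \<ge> 12"
  shows "typed (bound x m) x (locate i)"
proof -
  have "bound x m i + bound x m i \<le> x ^ 3"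
    using bound_le(2)[OF assms] power_add_le[OF assms(1), of 2 3 2] by linarith
  then show ?thesis
    using power_add_le[OF assms(1), of 3 4 2] power_add_le[OF assms(1), of 4 5 1]
      power_add_le[OF assms(1), of 5 6 1]
    by (simp add: locate_def bound_def)
qed

lemma typed_lookup:
  assumes "2 \<le> x" "m \<le> x\<^sup>2" "a \<ge> 12" "b \<ge> 12"
  shows "typed (bound x m) x (lookup a b)"
proof -
  have "bound x m a \<le> x\<^sup>2" "bound x m b \<le> x\<^sup>2" using assms bound_le(2) by auto
  then have "bound x m a * x \<le> x ^ 3" "x ^ 3 + bound x m b \<le> x ^ 4"
    using power_add_le[OF assms(1), of 3 4 2] mult_right_mono[of "bound x m a" "x\<^sup>2" x]
    by (simp_all add: power2_eq_square power3_eq_cube)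
  then show ?thesis
    using power_add_le[OF assms(1), of 4 5 1] by (simp add: lookup_def bound_def)
qed

lemma typed_check:
  assumes "2 \<le> x" "m \<le> x\<^sup>2"
  shows "typed (bound x m) x (check j i)"
proof (induction i)
  case (Suc i)
  then show ?case using typed_lookup[OF assms] by (simp add: probe_def)
qed (use assms in \<open>simp add: bound_def\<close>)

lemma typed_search:
  assumes "2 \<le> x" "m \<le> x\<^sup>2"
  shows "typed (bound x m) x (search j r)"
proof (induction r arbitrary: j)
  case 0
  then show ?case using assms by (simp add: bound_def)
next
  case (Suc r)
  have "typed (bound x m) x (locate (14 + 4 * j))" by (rule typed_locate[OF assms]) simp
  then have "typed (bound x m) x (fetch j)"
    using assms(1) self_le_power[of x 2] by (simp add: fetch_def) (simp add: bound_def)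
  moreover have "14 + 4 * j \<notin> writes (search (Suc j) r)" "4 \<notin> writes (search (Suc j) r)"
    using writes_search[of "Suc j" r] by force+
  moreover have "14 + 4 * j \<notin> writes (check j j)" "4 \<notin> writes (check j j)"
    using writes_check[of j j] by force+
  moreover have "bound x m 4 \<le> bound x m (14 + 4 * j)" "1 \<le> bound x m (17 + 4 * j)" "1 \<le> bound x m 5"
    using assms by (simp_all add: bound_def)
  ultimately show ?case
    using Suc typed_check[OF assms] assms by (simp add: writes_fetch)
qed

lemma typed_prep:
  assumes "2 \<le> x"
  shows "typed (bound x (x\<^sup>2)) x prep"
proof -
  have "12 \<notin> writes (lookup 12 13)" "13 \<notin> writes (lookup 12 13)" "2 \<notin> writes (lookup 12 13)"
    "12 \<notin> writes (locate 4)" "13 \<notin> writes (locate 4)" "2 \<notin> writes (locate 4)"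
    by (auto simp: lookup_def locate_def)
  moreover have "typed (bound x (x\<^sup>2)) x (locate 4)" "typed (bound x (x\<^sup>2)) x (lookup 12 13)"
    using assms by (auto intro: typed_locate typed_lookup)
  ultimately show ?thesis
    by (simp add: prep_def) (simp add: bound_def power2_eq_square)
qed

section \<open>Running times in terms of edges and vertices\<close>

lemma cost_check: "cost B (check j i) = 1 + 20 * i"
  by (induction i) (auto simp: probe_def lookup_def)

text \<open>\<open>C\<close> may depend on \<open>j\<close> and \<open>r\<close> only. Each nesting
  level contributes one factor \<open>m\<close>, the bound of register \<open>4\<close>;
  \<open>max 1 m\<close> absorbs additive constants when there are no edges.\<close>

lemma cost_search: "\<exists>C. \<forall>x m. cost (bound x m) (search j r) \<le> C * max 1 m ^ r"
proof (induction r arbitrary: j)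
  case 0
  show ?case by (intro exI[of _ 1]) simp
next
  case (Suc r)
  obtain C where C: "\<And>x m. cost (bound x m) (search (Suc j) r) \<le> C * max 1 m ^ r"
    using Suc by blast
  \<comment> \<open>Overhead of one round besides the recursive search: loop control
    \<open>2\<close>, \<open>fetch\<close> \<open>6\<close>, \<open>check\<close>
    \<open>1 + 20 * j\<close>, the guard \<open>2\<close>, setting the flag
    \<open>1\<close>.\<close>
  let ?K = "12 + 20 * j"
  have "cost (bound x m) (search j (Suc r)) \<le> (7 + ?K + C) * max 1 m ^ Suc r" for x m
  proof -
    define M where "M = max 1 m"
    have M: "1 \<le> M ^ r" "1 \<le> M ^ Suc r" "m \<le> M" by (auto simp: M_def)
    have "cost (bound x m) (search j (Suc r)) =
        7 + m * (?K + cost (bound x m) (search (Suc j) r))"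
      by (simp add: fetch_def locate_def cost_check bound_def algebra_simps)
    also have "\<dots> \<le> 7 * M ^ Suc r + M * (?K * M ^ r + C * M ^ r)"
      using M C[of x m] by (intro add_mono mult_mono) (auto simp: M_def)
    also have "\<dots> = (7 + ?K + C) * M ^ Suc r" by (simp add: algebra_simps)
    finally show ?thesis by (simp add: M_def)
  qed
  then show ?case by blast
qed

lemma cost_prep: "cost (bound (n + 2) m) prep \<le> 250 * max 1 n ^ 2"
proof -
  define N where "N = max 1 n"
  have N: "n + 2 \<le> 3 * N" "1 \<le> N" "5 \<le> 5 * (N * N)" by (auto simp: N_def)
  have "cost (bound x m) prep = 5 + x * (5 + x * 18)" for x
    by (simp add: prep_def lookup_def locate_def bound_def)
  then have "cost (bound (n + 2) m) prep = 5 + (n + 2) * (5 + (n + 2) * 18)" by blast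
  also have "\<dots> \<le> 5 * (N * N) + (3 * N) * (5 * N + (3 * N) * 18)"
    using N by (intro add_mono mult_mono) auto
  also have "\<dots> \<le> 250 * N ^ 2" by (simp add: power2_eq_square algebra_simps)
  finally show ?thesis by (simp add: N_def)
qed

section \<open>Assembly of the decision program\<close>

lemma words_bounded_within:
  assumes "2 \<le> x" "m \<le> x\<^sup>2" "within (bound x m) x (reg s, mem s)"
  shows "words_bounded (x ^ 6) s"
proof -
  have "x \<le> x ^ 6" using assms(1) by (intro self_le_power) auto
  moreover have "reg s r \<le> bound x m r" "mem s a \<le> x" for r a
    using assms(3) by (simp_all add: within_def)
  ultimately show ?thesis
    unfolding words_bounded_def using bound_le(1)[OF assms(1,2)] by (meson le_trans)
qed

lemma runs_weaken: "runs P Q T s s' \<Longrightarrow> (\<And>s. Q s \<Longrightarrow> Q' s) \<Longrightarrow> runs P Q' T s s'"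
  unfolding runs_def by blast

lemma decides_within_runs:
  "runs P (words_bounded W) T s s' \<Longrightarrow> halted_with P s' v \<Longrightarrow> decides_within P s v T W"
  unfolding runs_def decides_within_def by auto

lemma decides_within_mono:
  "decides_within P s v T W \<Longrightarrow> T \<le> T' \<Longrightarrow> decides_within P s v T' W"
  unfolding decides_within_def by (elim exE conjE) (intro exI conjI, auto)

definition decider :: "nat \<Rightarrow> program" where
  "decider k =
     (let code = compile 1 (prep ;; search 0 (Suc k)); l = 1 + length code
      in Const 1 1 # code @ [Jump_less 5 1 (l + 2), Halt False, Halt True])"

text \<open>The phases are measured with different bounds for register \<open>4\<close>: the crude
  \<open>(n + 2)\<^sup>2\<close> while edges are listed, then \<open>card E\<close> for the
  search.\<close>

lemma decider_decides:
  assumes G: "simple_graph {..<n} E"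
  shows "decides_within (decider k) (adjacency_input n E) (well_indumatched k E)
    (2 + cost (bound (n + 2) ((n + 2)\<^sup>2)) prep
       + cost (bound (n + 2) (card E)) (search 0 (Suc k)))
    ((n + 2) ^ 6)"
proof -
  define x where "x = n + 2"
  define Z where "Z = search 0 (Suc k)"
  define P where "P = decider k"
  define \<sigma> :: store where "\<sigma> = (\<lambda>_. 0, mem (adjacency_input n E))"
  define \<sigma>0 :: store where "\<sigma>0 = ((\<lambda>_. 0)(1 := 1), mem (adjacency_input n E))"
  define \<sigma>1 where "\<sigma>1 = sem prep \<sigma>0"
  define \<sigma>2 where "\<sigma>2 = sem Z \<sigma>1"
  define l1 where "l1 = 1 + length (compile 1 prep)"
  define l2 where "l2 = l1 + length (compile l1 Z)"
  let ?W = "words_bounded (x ^ 6)"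
  have x: "2 \<le> x" by (simp add: x_def)
  have m: "card E \<le> x\<^sup>2"
    using card_edges_le[OF G] by (simp add: x_def power2_eq_square)
  have "code_at P 0 (Const 1 1 # (compile 1 prep @ compile l1 Z) @
      [Jump_less 5 1 (l2 + 2), Halt False, Halt True])"
    unfolding code_at_def 
    by (simp add: P_def decider_def Let_def Z_def[symmetric] l1_def l2_def add.assoc
        del: search.simps)
  then have code: "0 < length P" "P ! 0 = Const 1 1" "code_at P 1 (compile 1 prep)"
    "code_at P l1 (compile l1 Z)"
    "l2 < length P" "P ! l2 = Jump_less 5 1 (l2 + 2)" "Suc l2 < length P" "P ! Suc l2 = Halt False"
    "l2 + 2 < length P" "P ! (l2 + 2) = Halt True"
    by (auto simp: code_at_Cons code_at_append l1_def l2_def add.assoc)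
  have input: "adjacency_input n E = at 0 \<sigma>"
    by (simp add: at_def \<sigma>_def adjacency_input_def)
  have mem: "mem (adjacency_input n E) a \<le> x" for a
    by (simp add: adjacency_input_def x_def)
  have w0: "within (bound x (x\<^sup>2)) x \<sigma>0"
    using mem x by (auto simp: within_def \<sigma>0_def bound_def)
  have W: "?W (at l \<tau>)" if "within (bound x m) x \<tau>" "m \<le> x\<^sup>2" for l \<tau> m
    using words_bounded_within[OF x that(2), of "at l \<tau>"] that by simp
  \<comment> \<open>Initially register \<open>1\<close> is still \<open>0\<close>, so
    \<open>within\<close> fails; the word bound is inherited from the larger store
    \<open>\<sigma>0\<close>.\<close>
  have "?W (at 0 \<sigma>)"
    using W[OF w0, of 0] by (auto simp: words_bounded_def \<sigma>_def \<sigma>0_def)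
  then have r0: "runs P ?W 1 (at 0 \<sigma>) (at 1 \<sigma>0)"
    using W[OF w0] code by (intro runs_step) (auto simp: step_def \<sigma>_def \<sigma>0_def)
  note prep = compile_correct[OF typed_prep[OF x] w0 code(3), folded \<sigma>1_def l1_def]
  have r1: "runs P ?W (cost (bound x (x\<^sup>2)) prep) (at 1 \<sigma>0) (at l1 \<sigma>1)"
    by (rule runs_weaken[OF conjunct2[OF prep]]) (rule words_bounded_within[OF x order_refl])
  have gathered: "gathered n E (edge_list n E) \<sigma>1"
    unfolding \<sigma>1_def \<sigma>0_def by (rule sem_prep)
  then have ready: "ready n E (edge_list n E) \<sigma>1" "fst \<sigma>1 5 = 0" by (auto simp: gathered_def)
  \<comment> \<open>The switch of bounds: they differ at register \<open>4\<close> alone, whose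
    value is now known exactly.\<close>
  have "fst \<sigma>1 4 = card E" using ready(1) length_edge_list[OF G] by (simp add: ready_def)
  then have w1: "within (bound x (card E)) x \<sigma>1"
    using conjunct1[OF prep] bound_cong[of _ x "x\<^sup>2" "card E"]
    unfolding within_def by (metis bound_def order_refl)
  note search = compile_correct[OF typed_search[OF x m, of 0 "Suc k", folded Z_def] w1 code(4),
      folded \<sigma>2_def l2_def]
  have r2: "runs P ?W (cost (bound x (card E)) Z) (at l1 \<sigma>1) (at l2 \<sigma>2)"
    by (rule runs_weaken[OF conjunct2[OF search]]) (rule words_bounded_within[OF x m])
  have "fst \<sigma>2 5 = (if accepts E (edge_list n E) (Suc k) [] then 0 else 1)"
    using sem_search[where xs = "[]" and r = "Suc k", OF edge_list_less ready(1)] ready(2)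
    by (simp add: \<sigma>2_def Z_def)
  then have flag: "fst \<sigma>2 5 = (if well_indumatched k E then 0 else 1)"
    by (simp only: accepts_iff_well_indumatched[OF G edge_image_edge_list[OF G]])
  define l3 where "l3 = (if well_indumatched k E then l2 + 2 else Suc l2)"
  have w2: "within (bound x (card E)) x \<sigma>2" using search by blast
  then have "fst \<sigma>2 1 = 1" by (simp add: within_def)
  then have r3: "runs P ?W 1 (at l2 \<sigma>2) (at l3 \<sigma>2)"
    using code flag W[OF w2 m] by (intro runs_step) (auto simp: step_def l3_def)
  have "halted_with P (at l3 \<sigma>2) (well_indumatched k E)"
    using code by (simp add: halted_with_def l3_def)
  moreover have "runs P ?W (2 + cost (bound x (x\<^sup>2)) prep + cost (bound x (card E)) Z)
      (adjacency_input n E) (at l3 \<sigma>2)"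
    using runs_mono[OF runs_trans[OF r0 runs_trans[OF r1 runs_trans[OF r2 r3]]]]
    unfolding input by simp
  ultimately show ?thesis
    unfolding x_def P_def Z_def by (intro decides_within_runs)
qed

theorem theorem5p5:
  fixes k :: nat
  assumes "k \<ge> 1"
  shows "\<exists>P C d. \<forall>n E. simple_graph {..<n} E \<longrightarrow>
           decides_within P (adjacency_input n E) (well_indumatched k E)
             (C * (max 1 (card E)) ^ (k - 1) * (max 1 n) ^ 4)
             ((n + 2) ^ d)"
proof -
  obtain C where C: "\<And>x m. cost (bound x m) (search 0 (Suc k)) \<le> C * max 1 m ^ Suc k"
    using cost_search by blast
  have "decides_within (decider k) (adjacency_input n E) (well_indumatched k E)
      ((252 + C) * max 1 (card E) ^ (k - 1) * max 1 n ^ 4) ((n + 2) ^ 6)"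
    if G: "simple_graph {..<n} E" for n E
  proof -
    \<comment> \<open>Both factors are kept positive, so that additive constants are absorbed even
      for edgeless or empty graphs.\<close>
    define M where "M = max 1 (card E)"
    define N where "N = max 1 n"
    have N: "1 \<le> N" "n \<le> N" by (auto simp: N_def)
    then have "n * n \<le> N * N" "1 \<le> N * N" by (auto intro: mult_le_mono)
    then have "M \<le> N\<^sup>2"
      using card_edges_le[OF G] by (simp add: M_def power2_eq_square)
    then have M2: "M\<^sup>2 \<le> N ^ 4"
      using power_mono[of M "N\<^sup>2" 2] by simp
    have M: "1 \<le> M ^ (k - 1)" by (simp add: M_def)
    have "N\<^sup>2 \<le> N ^ 4" "1 \<le> N ^ 4" using N by (auto intro: power_increasing)
    then have low: "N\<^sup>2 \<le> M ^ (k - 1) * N ^ 4" "1 \<le> M ^ (k - 1) * N ^ 4"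
      using mult_le_mono[OF M] by fastforce+
    \<comment> \<open>Here \<open>k \<ge> 1\<close> enters. Two of the \<open>k + 1\<close> factors
      \<open>M\<close> are traded for \<open>N ^ 4\<close>.\<close>
    have "Suc k = (k - 1) + 2" using assms by simp
    then have "M ^ Suc k = M ^ (k - 1) * M\<^sup>2" by (metis power_add)
    also have "\<dots> \<le> M ^ (k - 1) * N ^ 4" using M2 by simp
    finally have high: "M ^ Suc k \<le> M ^ (k - 1) * N ^ 4" .
    have "2 + cost (bound (n + 2) ((n + 2)\<^sup>2)) prep + cost (bound (n + 2) (card E)) (search 0 (Suc k))
        \<le> 2 + 250 * N\<^sup>2 + C * M ^ Suc k"
      using cost_prep[of n "(n + 2)\<^sup>2"] C[of "n + 2" "card E"] unfolding M_def N_def by linarith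
    also have "\<dots> \<le> 2 * (M ^ (k - 1) * N ^ 4) + 250 * (M ^ (k - 1) * N ^ 4) + C * (M ^ (k - 1) * N ^ 4)"
      using low high by (intro add_mono mult_le_mono2) auto
    also have "\<dots> = (252 + C) * M ^ (k - 1) * N ^ 4" by (simp add: algebra_simps)
    finally show ?thesis
      unfolding M_def N_def by (rule decides_within_mono[OF decider_decides[OF G]])
  qed
  then show ?thesis by (intro exI allI impI)
qed

end
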